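(* Let $R_n(x)=\sum_{k=0}^{n-1} c_n(k)x^k$ for $n\ge 1$. (i) For every $n\ge 1$, $R_n(x)=\frac{n}{\gamma(n)}R_{\gamma(n)}\big(x^{n/\gamma(n)}\big)$. (ii) Let $n\ge 1$ and $p$ a prime. If $p\mid n$ then $R_{np}(x)=pR_n(x^p)$. If $p\nmid n$ then $R_{np}(x)=pR_n(x^p)-(1+x^n+x^{2n}+\cdots+x^{(p-1)n})R_n(x)$. (iii) If $n>1$, $p$ is a prime and $p\nmid n$, then $1-x^p$ divides $R_{np}(x)$.
   Context: For integers $n\ge 1$ and $k$, the Ramanujan sum is $c_n(k)=\sum_{1\le j\le n,\ \gcd(j,n)=1} e^{2\pi i jk/n}$. $\gamma(n)=\prod_{p\mid n}p$ is the product of the distinct primes dividing $n$ ($\gamma(1)=1$). *)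

theory Defs
  imports
    Complex_Main
    "HOL-Computational_Algebra.Polynomial"
    "HOL-Computational_Algebra.Primes"
begin

definition ramanujan_sum :: "nat \<Rightarrow> int \<Rightarrow> complex" where
  "ramanujan_sum n k =
     (\<Sum>j | 1 \<le> j \<and> j \<le> n \<and> gcd j n = 1.
        exp (2 * of_real pi * \<i> * of_nat j * of_int k / of_nat n))"

definition squarefree_kernel :: "nat \<Rightarrow> nat" where
  "squarefree_kernel n = (\<Prod>p | prime p \<and> p dvd n. p)"

definition ramanujan_poly :: "nat \<Rightarrow> complex poly" where
  "ramanujan_poly n = (\<Sum>k<n. monom (ramanujan_sum n (int k)) k)"

end

theory Submission
  imports
    Defs
    "HOL-Computational_Algebra.Squarefree"
    "HOL-Analysis.Complex_Transcendental"
    "HOL-Number_Theory.Cong"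
begin

text \<open>
  Writing the residues \<open>j \<in> {1..n * p}\<close> coprime to \<open>n\<close> as \<open>i + n * t\<close> and summing over \<open>t\<close> first gives
  \<open>p * c\<^sub>n(k / p)\<close> if \<open>p\<close> divides \<open>k\<close>, and \<open>0\<close> otherwise. If \<open>p\<close> divides \<open>n\<close>, this is \<open>c\<^sub>n\<^sub>p(k)\<close>; if not,
  the multiples of \<open>p\<close> have to be removed, and they contribute \<open>c\<^sub>n(k)\<close>. Comparing coefficients yields
  (ii), and (i) follows by stripping repeated prime factors one at a time. For (iii), \<open>1 - x\<close>
  divides \<open>R\<^sub>n\<close> because \<open>R\<^sub>n(1) = 0\<close>, hence \<open>1 - x\<^sup>p\<close> divides \<open>R\<^sub>n(x\<^sup>p)\<close>; modulo \<open>1 - x\<^sup>p\<close> the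
  exponents \<open>j * n\<close> for \<open>j < p\<close> run through all residues, so \<open>(1 - x) * (\<Sum>j<p. x\<^bsup>j * n\<^esup>)\<close> vanishes.
\<close>

section \<open>Roots of unity and their orthogonality\<close>

definition root_of_unity :: "nat \<Rightarrow> nat \<Rightarrow> complex" where
  "root_of_unity n m = exp (2 * of_real pi * \<i> * of_nat m / of_nat n)"

lemma root_of_unity_0 [simp]: "root_of_unity n 0 = 1"
  by (simp add: root_of_unity_def)

lemma root_of_unity_add: "root_of_unity n (a + b) = root_of_unity n a * root_of_unity n b"
  by (simp add: root_of_unity_def exp_add [symmetric] add_divide_distrib algebra_simps)

lemma root_of_unity_mult: "root_of_unity n (a * b) = root_of_unity n a ^ b"
  by (induction b) (simp_all add: root_of_unity_add)

lemma root_of_unity_cancel: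
  "c > 0 \<Longrightarrow> root_of_unity (n * c) (m * c) = root_of_unity n m"
  by (simp add: root_of_unity_def mult.assoc)

lemma root_of_unity_eq_1_iff:
  assumes "n > 0"
  shows "root_of_unity n m = 1 \<longleftrightarrow> n dvd m"
  using assms by (simp add: root_of_unity_def complex_root_unity_eq_1)

text \<open>A geometric sum whose ratio \<open>root_of_unity n m\<close> has \<open>n\<close>-th
  power 1: the closed form has numerator 0 unless the ratio itself is 1, which happens exactly when
  \<open>n\<close> divides \<open>m\<close>.\<close>

lemma sum_root_of_unity:
  assumes "n > 0"
  shows "(\<Sum>t<n. root_of_unity n (m * t)) = (if n dvd m then of_nat n else 0)"
proof -
  have "root_of_unity n m ^ n = 1"
    using assms by (simp flip: root_of_unity_mult add: root_of_unity_eq_1_iff)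
  then show ?thesis
    using assms by (simp add: root_of_unity_mult root_of_unity_eq_1_iff [symmetric] geometric_sum)
qed

section \<open>Ramanujan sums: periodicity and passing from \<open>n\<close> to
  \<open>n * p\<close>\<close>

lemma ramanujan_sum_root_of_unity:
  "ramanujan_sum n (int k) = (\<Sum>j | 1 \<le> j \<and> j \<le> n \<and> coprime j n. root_of_unity n (j * k))"
  by (simp add: ramanujan_sum_def root_of_unity_def coprime_iff_gcd_eq_1 mult.assoc)

lemma ramanujan_sum_mod:
  assumes "n > 0"
  shows "ramanujan_sum n (int (k mod n)) = ramanujan_sum n (int k)"
proof -
  have "root_of_unity n (j * k) = root_of_unity n (j * (k mod n))" for j
  proof -
    have "j * k = n * (j * (k div n)) + j * (k mod n)"
      by (metis div_mult_mod_eq distrib_left mult.assoc mult.commute)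
    then show ?thesis
      using assms root_of_unity_eq_1_iff [of n "n * (j * (k div n))"]
      by (simp only: root_of_unity_add) simp
  qed
  then show ?thesis by (simp add: ramanujan_sum_root_of_unity)
qed

text \<open>Coprimality is required to \<open>n\<close> only, not to \<open>n * p\<close>, so each
  admissible residue modulo \<open>n\<close> has exactly \<open>p\<close> lifts
  \<open>i + n * t\<close>. This keeps the computation common to both cases, \<open>p dvd n\<close>
  and its negation.\<close>

lemma sum_coprime_mult:
  fixes n p k :: nat
  assumes "n > 0" "p > 0"
  shows "(\<Sum>j | 1 \<le> j \<and> j \<le> n * p \<and> coprime j n. root_of_unity (n * p) (j * k)) =
         (if p dvd k then of_nat p * ramanujan_sum n (int (k div p)) else 0)"
proof -
  define A where "A = {j. 1 \<le> j \<and> j \<le> n \<and> coprime j n}"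
  define B where "B = {j. 1 \<le> j \<and> j \<le> n * p \<and> coprime j n}"
  have cop: "coprime (i + n * t) n \<longleftrightarrow> coprime i n" for i t
    by (metis coprime_iff_gcd_eq_1 gcd.commute gcd_add_mult mult.commute add.commute)
  have bij: "bij_betw (\<lambda>(i, t). i + n * t) (A \<times> {..<p}) B"
  \<comment> \<open>The residues run from 1 to \<open>n\<close> instead of 0 to
    \<open>n - 1\<close>; hence the shift by 1 around \<open>mod\<close> and
    \<open>div\<close>.\<close>
  proof (rule bij_betw_byWitness [where f' = "\<lambda>j. ((j - 1) mod n + 1, (j - 1) div n)"])
    show "\<forall>a\<in>A \<times> {..<p}. (\<lambda>j. ((j - 1) mod n + 1, (j - 1) div n))
            ((\<lambda>(i, t). i + n * t) a) = a"
    proof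
      fix a assume "a \<in> A \<times> {..<p}"
      then obtain i t where a: "a = (i, t)" "i \<in> A" by auto
      from \<open>i \<in> A\<close> obtain i' where "i = Suc i'" "i' < n"
        unfolding A_def by (cases i) auto
      then show "(\<lambda>j. ((j - 1) mod n + 1, (j - 1) div n)) ((\<lambda>(i, t). i + n * t) a) = a"
        by (simp add: a)
    qed
    show inv: "\<forall>j\<in>B. (\<lambda>(i, t). i + n * t) ((j - 1) mod n + 1, (j - 1) div n) = j"
      by (auto simp: B_def)
    show "(\<lambda>(i, t). i + n * t) ` (A \<times> {..<p}) \<subseteq> B"
    proof
      fix j assume "j \<in> (\<lambda>(i, t). i + n * t) ` (A \<times> {..<p})"
      then obtain i t where *: "i \<in> A" "t < p" "j = i + n * t" by auto
      then have "n * (t + 1) \<le> n * p" by (intro mult_le_mono2) auto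
      with * show "j \<in> B" by (auto simp: A_def B_def cop)
    qed
    show "(\<lambda>j. ((j - 1) mod n + 1, (j - 1) div n)) ` B \<subseteq> A \<times> {..<p}"
    proof (rule image_subsetI)
      fix j assume j: "j \<in> B"
      then have "coprime ((j - 1) mod n + 1) n"
        using inv cop [of "(j - 1) mod n + 1" "(j - 1) div n"] by (auto simp: B_def)
      moreover have "(j - 1) div n < p"
        using j assms by (auto simp: B_def less_mult_imp_div_less mult.commute)
      ultimately show "((j - 1) mod n + 1, (j - 1) div n) \<in> A \<times> {..<p}"
        using assms by (auto simp: A_def Suc_le_eq)
    qed
  qed
  have "(\<Sum>j\<in>B. root_of_unity (n * p) (j * k)) =
             (\<Sum>(i, t)\<in>A \<times> {..<p}. root_of_unity (n * p) ((i + n * t) * k))"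
    using sum.reindex_bij_betw [OF bij, of "\<lambda>j. root_of_unity (n * p) (j * k)"]
    by (simp only: case_prod_unfold)
  also have "\<dots> = (\<Sum>i\<in>A. \<Sum>t<p. root_of_unity (n * p) (i * k) * root_of_unity p (k * t))"
  proof -
    \<comment> \<open>The factor \<open>n\<close> cancels in \<open>n * t * k / (n * p)\<close>,
      leaving a \<open>p\<close>-th root of unity independent of \<open>i\<close>, so the sum over
      \<open>t\<close> can be evaluated by orthogonality.\<close>
    have "root_of_unity (n * p) ((i + n * t) * k) =
          root_of_unity (n * p) (i * k) * root_of_unity p (k * t)" for i t
      using root_of_unity_cancel [of n p "k * t"] assms
      by (simp add: root_of_unity_add algebra_simps)
    then show ?thesis by (simp add: sum.cartesian_product)
  qed
  also have "\<dots> = (\<Sum>i\<in>A. root_of_unity (n * p) (i * k) * (if p dvd k then of_nat p else 0))"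
    using assms by (simp add: sum_distrib_left [symmetric] sum_root_of_unity)
  also have "\<dots> = (if p dvd k then of_nat p * ramanujan_sum n (int (k div p)) else 0)"
  proof (cases "p dvd k")
    case True
    then obtain l where l: "k = l * p" by (metis dvdE mult.commute)
    have "root_of_unity (n * p) (i * k) = root_of_unity n (i * l)" for i
      using root_of_unity_cancel [of p n "i * l"] assms by (simp add: l mult.assoc)
    then show ?thesis
      using assms l
      by (simp add: ramanujan_sum_root_of_unity A_def sum_distrib_left mult.commute [of _ "of_nat p"])
  qed simp
  finally show ?thesis by (simp add: B_def)
qed

text \<open>Since \<open>p\<close> divides \<open>n\<close>, being coprime to \<open>n * p\<close>
  and being coprime to \<open>n\<close> are the same condition.\<close>

lemma ramanujan_sum_mult_prime_dvd:
  assumes "n > 0" "prime p" "p dvd n"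
  shows "ramanujan_sum (n * p) (int k) =
         (if p dvd k then of_nat p * ramanujan_sum n (int (k div p)) else 0)"
proof -
  have "coprime j (n * p) \<longleftrightarrow> coprime j n" for j
    using assms(3) coprime_divisors by (auto simp: coprime_mult_right_iff)
  then show ?thesis
    using sum_coprime_mult [OF assms(1) prime_gt_0_nat [OF assms(2)], of k]
    by (simp only: ramanujan_sum_root_of_unity [of "n * p"])
qed

text \<open>Among the \<open>j\<close> coprime to \<open>n\<close>, those not coprime to
  \<open>n * p\<close> are the multiples \<open>i * p\<close> with \<open>i\<close> coprime to
  \<open>n\<close>. On them \<open>p\<close> cancels in the exponent, so together they contribute
  the Ramanujan sum of \<open>n\<close>.\<close>

lemma ramanujan_sum_mult_prime_not_dvd:
  assumes "n > 0" "prime p" "\<not> p dvd n"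
  shows "ramanujan_sum (n * p) (int k) =
         (if p dvd k then of_nat p * ramanujan_sum n (int (k div p)) else 0)
         - ramanujan_sum n (int k)"
proof -
  define A where "A = {j. 1 \<le> j \<and> j \<le> n \<and> coprime j n}"
  define B where "B = {j. 1 \<le> j \<and> j \<le> n * p \<and> coprime j n}"
  define C where "C = {j. 1 \<le> j \<and> j \<le> n * p \<and> coprime j (n * p)}"
  have p: "p > 0" using assms by (simp add: prime_gt_0_nat)
  have cop: "coprime p n" using assms by (simp add: prime_imp_coprime)
  have fin: "finite B" unfolding B_def by (rule finite_subset [of _ "{..n * p}"]) auto
  have sub: "(\<lambda>i. i * p) ` A \<subseteq> B"
    using p cop by (auto simp: A_def B_def)
  have C: "C = B - (\<lambda>i. i * p) ` A"
  proof (intro equalityI subsetI)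
    fix j assume "j \<in> C"
    moreover have "\<not> coprime (i * p) (n * p)" for i
      using assms(2) by (auto simp: coprime_mult_left_iff coprime_mult_right_iff)
    ultimately show "j \<in> B - (\<lambda>i. i * p) ` A"
      by (auto simp: B_def C_def)
  next
    fix j assume j: "j \<in> B - (\<lambda>i. i * p) ` A"
    have "\<not> p dvd j"
    proof
      assume "p dvd j"
      then obtain i where i: "j = i * p" by (metis dvdE mult.commute)
      with j p have "i \<in> A" by (auto simp: A_def B_def)
      with i j show False by auto
    qed
    then have "coprime j p"
      using assms(2) prime_imp_coprime [of p j] by (simp add: coprime_commute)
    with j show "j \<in> C" by (auto simp: B_def C_def)
  qed
  have "(\<Sum>j\<in>(\<lambda>i. i * p) ` A. root_of_unity (n * p) (j * k)) = ramanujan_sum n (int k)"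
  proof -
    have "(\<Sum>j\<in>(\<lambda>i. i * p) ` A. root_of_unity (n * p) (j * k)) =
          (\<Sum>i\<in>A. root_of_unity (n * p) (i * k * p))"
      using p by (subst sum.reindex) (auto simp: inj_on_def ac_simps)
    then show ?thesis
      using p by (simp add: root_of_unity_cancel ramanujan_sum_root_of_unity A_def)
  qed
  moreover have "(\<Sum>j\<in>B. root_of_unity (n * p) (j * k)) =
         (if p dvd k then of_nat p * ramanujan_sum n (int (k div p)) else 0)"
    unfolding B_def using assms p by (intro sum_coprime_mult) auto
  moreover have "ramanujan_sum (n * p) (int k) = (\<Sum>j\<in>C. root_of_unity (n * p) (j * k))"
    by (simp add: ramanujan_sum_root_of_unity C_def)
  ultimately show ?thesis
    using fin sub by (simp add: C sum_diff)
qed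

section \<open>Coefficients of the polynomials in the recurrences\<close>

lemma coeff_ramanujan_poly:
  "coeff (ramanujan_poly n) k = (if k < n then ramanujan_sum n (int k) else 0)"
  by (simp add: ramanujan_poly_def coeff_sum)

lemma pcompose_monom_left:
  fixes q :: "'a::comm_semiring_1 poly"
  shows "pcompose (monom a k) q = smult a (q ^ k)"
  by (induction k) (simp_all add: monom_Suc monom_0 pcompose_pCons)

lemma pcompose_ramanujan_poly_monom:
  "pcompose (ramanujan_poly n) (monom 1 p) =
   (\<Sum>k<n. monom (ramanujan_sum n (int k)) (k * p))"
  by (simp add: ramanujan_poly_def pcompose_sum pcompose_monom_left monom_power smult_monom mult.commute)

lemma coeff_pcompose_ramanujan_poly_monom:
  assumes "p > 0"
  shows "coeff (pcompose (ramanujan_poly n) (monom 1 p)) k =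
         (if k < n * p \<and> p dvd k then ramanujan_sum n (int (k div p)) else 0)"
proof (cases "p dvd k")
  case True
  then obtain l where "k = l * p" by (metis dvdE mult.commute)
  then show ?thesis
    using assms by (simp add: pcompose_ramanujan_poly_monom coeff_sum)
next
  case False
  then have "i * p \<noteq> k" for i by auto
  with False show ?thesis
    by (simp add: pcompose_ramanujan_poly_monom coeff_sum)
qed

text \<open>The shifted copies of \<open>ramanujan_poly n\<close> occupy disjoint blocks of
  \<open>n\<close> consecutive exponents, so only \<open>j = k div n\<close> contributes to
  coefficient \<open>k\<close>. Its contribution is the Ramanujan sum at \<open>k mod n\<close>,
  which periodicity turns into the one at \<open>k\<close>.\<close>

lemma coeff_sum_monom_mult_ramanujan_poly:
  assumes "n > 0"
  shows "coeff ((\<Sum>j<p. monom 1 (j * n)) * ramanujan_poly n) k =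
         (if k < n * p then ramanujan_sum n (int k) else 0)"
proof -
  have *: "coeff (monom 1 (j * n) * ramanujan_poly n) k =
        (if j = k div n then ramanujan_sum n (int k) else 0)" for j
  proof -
    have "j * n \<le> k \<and> k - j * n < n \<longleftrightarrow> j = k div n"
    proof
      assume "j * n \<le> k \<and> k - j * n < n"
      then have "k div n = (k - j * n + j * n) div n" "(k - j * n) div n = 0"
        by auto
      then show "j = k div n"
        using assms by simp
    qed (use assms in \<open>simp add: minus_div_mult_eq_mod\<close>)
    moreover have "k - (k div n) * n = k mod n"
      by (simp add: minus_div_mult_eq_mod)
    ultimately show ?thesis
      using ramanujan_sum_mod [OF assms, of k]
      by (auto simp: coeff_monom_mult coeff_ramanujan_poly not_le)
  qed
  have "k div n < p \<longleftrightarrow> k < n * p"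
    using assms by (simp add: div_less_iff_less_mult mult.commute)
  then show ?thesis
    by (simp add: sum_distrib_right coeff_sum *)
qed

section \<open>The two recurrences\<close>

lemma ramanujan_poly_mult_prime_dvd:
  assumes "n > 0" "prime p" "p dvd n"
  shows "ramanujan_poly (n * p) = smult (of_nat p) (pcompose (ramanujan_poly n) (monom 1 p))"
  using assms
  by (intro poly_eqI)
     (simp add: coeff_ramanujan_poly coeff_pcompose_ramanujan_poly_monom prime_gt_0_nat
       ramanujan_sum_mult_prime_dvd del: of_nat_mult)

lemma ramanujan_poly_mult_prime_not_dvd:
  assumes "n > 0" "prime p" "\<not> p dvd n"
  shows "ramanujan_poly (n * p) = smult (of_nat p) (pcompose (ramanujan_poly n) (monom 1 p))
           - (\<Sum>j<p. monom 1 (j * n)) * ramanujan_poly n"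
  using assms
  by (intro poly_eqI)
     (simp add: coeff_ramanujan_poly coeff_pcompose_ramanujan_poly_monom prime_gt_0_nat
       ramanujan_sum_mult_prime_not_dvd coeff_sum_monom_mult_ramanujan_poly)

section \<open>Reduction to the squarefree kernel\<close>

lemma squarefree_kernel_mult_prime_dvd:
  assumes "prime p" "p dvd n"
  shows "squarefree_kernel (n * p) = squarefree_kernel n"
proof -
  have "{q. prime q \<and> q dvd n * p} = {q. prime q \<and> q dvd n}"
    using assms by (auto simp: prime_dvd_mult_iff primes_dvd_imp_eq)
  then show ?thesis by (simp add: squarefree_kernel_def)
qed

lemma squarefree_kernel_prime_factors:
  "n > 0 \<Longrightarrow> squarefree_kernel n = \<Prod>(prime_factors n)"
  by (simp add: squarefree_kernel_def prime_factors_dvd)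

lemma squarefree_kernel_squarefree:
  assumes "squarefree n"
  shows "squarefree_kernel n = n"
proof -
  have n: "n > 0" using assms by (auto intro: Nat.gr0I)
  then have "squarefree_kernel n = (\<Prod>p\<in>prime_factors n. p ^ multiplicity p n)"
    using assms by (auto simp: squarefree_kernel_prime_factors squarefree_factorial_semiring'
      intro!: prod.cong)
  then show ?thesis using n by (simp add: prod_prime_factors)
qed

lemma squarefree_kernel_dvd:
  assumes "n > 0"
  shows "squarefree_kernel n dvd n"
proof -
  have "\<Prod>(prime_factors n) dvd (\<Prod>p\<in>prime_factors n. p ^ multiplicity p n)"
    using assms by (intro prod_dvd_prod) (auto simp: prime_factors_multiplicity)
  then show ?thesis
    using assms by (simp add: squarefree_kernel_prime_factors prod_prime_factors)
qed

lemma pcompose_monom_monom: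
  fixes q :: "'a::comm_semiring_1 poly"
  shows "pcompose (pcompose q (monom 1 a)) (monom 1 b) = pcompose q (monom 1 (a * b))"
  by (simp add: pcompose_assoc [symmetric] pcompose_monom_left monom_power mult.commute)

lemma ramanujan_poly_squarefree_kernel:
  assumes "n > 0"
  shows "ramanujan_poly n = smult (of_nat n / of_nat (squarefree_kernel n))
           (pcompose (ramanujan_poly (squarefree_kernel n))
              (monom 1 (n div squarefree_kernel n)))"
  using assms
proof (induction n rule: less_induct)
  case (less n)
  show ?case
  proof (cases "squarefree n")
    case True
    then show ?thesis using less.prems
      by (simp add: squarefree_kernel_squarefree monom_Suc monom_0 pcompose_idR)
  next
    case False
    then obtain p where p: "prime p" "p ^ 2 dvd n"
      using less.prems squarefree_factorial_semiring [of n] by auto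
    then obtain l where l: "n = p ^ 2 * l" by auto
    \<comment> \<open>Only one factor \<open>p\<close> is removed: \<open>p\<close> still divides
      \<open>m\<close>, so the kernel is unchanged and the recurrence for \<open>p dvd m\<close>
      applies.\<close>
    define m where "m = p * l"
    have m: "n = m * p" "p dvd m" "m > 0" "m < n"
      using l less.prems prime_gt_1_nat [OF p(1)] by (auto simp: m_def power2_eq_square)
    define r where "r = squarefree_kernel m"
    have r: "squarefree_kernel n = r" "r dvd m"
      using m p by (simp_all add: r_def squarefree_kernel_mult_prime_dvd squarefree_kernel_dvd)
    have "ramanujan_poly n = smult (of_nat p) (pcompose (ramanujan_poly m) (monom 1 p))"
      using m p by (simp add: ramanujan_poly_mult_prime_dvd)
    also have "\<dots> = smult (of_nat n / of_nat r)
                      (pcompose (ramanujan_poly r) (monom 1 ((m div r) * p)))"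
      by (subst less.IH [OF m(4,3)])
         (simp add: r_def [symmetric] pcompose_smult pcompose_monom_monom m(1) mult.commute)
    also have "m div r * p = n div r"
      using r(2) by (simp add: m(1) div_mult_swap mult.commute)
    finally show ?thesis by (simp add: r(1))
  qed
qed

section \<open>Divisibility by \<open>1 - monom 1 p\<close>\<close>

lemma poly_ramanujan_poly_1:
  assumes "n > 1"
  shows "poly (ramanujan_poly n) 1 = 0"
proof -
  have "poly (ramanujan_poly n) 1 =
        (\<Sum>j | 1 \<le> j \<and> j \<le> n \<and> coprime j n. \<Sum>k<n. root_of_unity n (j * k))"
    by (simp add: ramanujan_poly_def poly_sum poly_monom ramanujan_sum_root_of_unity
        sum.swap [of _ "{..<n}"])
  also have "\<dots> = 0"
  proof (rule sum.neutral, rule ballI)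
    fix j assume "j \<in> {j. 1 \<le> j \<and> j \<le> n \<and> coprime j n}"
    \<comment> \<open>A \<open>j\<close> both coprime to \<open>n\<close> and divisible by
      \<open>n\<close> would force \<open>n = 1\<close>.\<close>
    then have "\<not> n dvd j"
      using assms by (auto simp: coprime_absorb_right)
    then show "(\<Sum>k<n. root_of_unity n (j * k)) = 0"
      using assms by (simp add: sum_root_of_unity)
  qed
  finally show ?thesis .
qed

lemma one_minus_monom_dvd_geometric:
  fixes n p :: nat
  assumes "coprime n p" "p > 0"
  shows "(1 - monom 1 p :: 'a::comm_ring_1 poly) dvd (1 - monom 1 1) * (\<Sum>j<p. monom 1 (j * n))"
proof -
  let ?d = "1 - monom 1 p :: 'a poly"
  \<comment> \<open>Exponents may be reduced modulo \<open>p\<close>, because \<open>1 - y\<close>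
    divides \<open>1 - y ^ q\<close>, applied to \<open>y = monom 1 p\<close> and
    \<open>q = m div p\<close>.\<close>
  have red: "?d dvd monom 1 (m mod p) - monom 1 m" for m
  proof -
    have "monom 1 (m mod p) - monom 1 m = monom 1 (m mod p) * (1 - monom (1::'a) p ^ (m div p))"
      by (simp add: right_diff_distrib mult_monom monom_power)
    moreover have "?d dvd 1 - monom 1 p ^ (m div p)"
      by (simp add: one_diff_power_eq)
    ultimately show ?thesis by simp
  qed
  \<comment> \<open>Multiplication by \<open>n\<close> is invertible modulo \<open>p\<close>, so it
    permutes the residues; the reduced sum is then the full geometric sum, which
    \<open>1 - monom 1 1\<close> completes to \<open>?d\<close>.\<close>
  have inj: "inj_on (\<lambda>j. j * n mod p) {..<p}"
  proof (rule inj_onI)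
    fix i j assume *: "i \<in> {..<p}" "j \<in> {..<p}" "i * n mod p = j * n mod p"
    then have "[i = j] (mod p)"
      using cong_mult_rcancel_nat [OF assms(1)] by (simp add: cong_def)
    with * show "i = j"
      by (simp add: cong_less_modulus_unique_nat)
  qed
  moreover have "(\<lambda>j. j * n mod p) ` {..<p} \<subseteq> {..<p}"
    using assms by auto
  ultimately have "bij_betw (\<lambda>j. j * n mod p) {..<p} {..<p}"
    by (simp add: bij_betw_def endo_inj_surj)
  then have "(\<Sum>j<p. monom (1::'a) (j * n mod p)) = (\<Sum>j<p. monom 1 j)"
    by (rule sum.reindex_bij_betw)
  moreover have "(1 - monom 1 1) * (\<Sum>j<p. monom (1::'a) j) = ?d"
    using one_diff_power_eq [of "monom (1::'a) 1" p] by (simp add: monom_power)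
  moreover have "?d dvd (\<Sum>j<p. monom 1 (j * n mod p)) - (\<Sum>j<p. monom 1 (j * n))"
    unfolding sum_subtractf [symmetric] by (intro dvd_sum red)
  then have "?d dvd (1 - monom 1 1) * ((\<Sum>j<p. monom 1 (j * n mod p)) - (\<Sum>j<p. monom 1 (j * n)))"
    by (rule dvd_mult)
  ultimately have "?d dvd ?d - (1 - monom 1 1) * (\<Sum>j<p. monom 1 (j * n))"
    by (simp add: right_diff_distrib)
  then show ?thesis
    by (metis dvd_diff_right_iff dvd_refl)
qed

text \<open>The factor \<open>1 - monom 1 1\<close> of \<open>ramanujan_poly n\<close> serves both
  terms of the recurrence: substitution turns it into \<open>1 - monom 1 p\<close> in the first, and
  in the second it multiplies the sum of the \<open>monom 1 (j * n)\<close>.\<close>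

lemma one_minus_monom_dvd_ramanujan_poly:
  assumes "n > 1" "prime p" "\<not> p dvd n"
  shows "(1 - monom 1 p) dvd ramanujan_poly (n * p)"
proof -
  have p: "p > 0" "coprime n p"
    using assms prime_imp_coprime [of p n] by (simp_all add: prime_gt_0_nat coprime_commute)
  have "[:-1, 1:] dvd ramanujan_poly n"
    using poly_ramanujan_poly_1 [OF assms(1)] by (simp add: poly_eq_0_iff_dvd)
  moreover have "[:-1, 1:] = - (1 - monom (1::complex) 1)"
    by (simp add: monom_Suc monom_0 one_pCons)
  ultimately have "1 - monom 1 1 dvd ramanujan_poly n"
    by (metis minus_dvd_iff)
  then obtain q where q: "ramanujan_poly n = (1 - monom 1 1) * q" ..
  have "pcompose (ramanujan_poly n) (monom 1 p) = (1 - monom 1 p) * pcompose q (monom 1 p)"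
    by (simp add: q pcompose_mult pcompose_diff pcompose_1 pcompose_monom_left)
  then have "1 - monom 1 p dvd smult (of_nat p) (pcompose (ramanujan_poly n) (monom 1 p))"
    by (simp add: dvd_smult)
  moreover have "1 - monom 1 p dvd (\<Sum>j<p. monom 1 (j * n)) * ramanujan_poly n"
    using dvd_mult2 [OF one_minus_monom_dvd_geometric [OF p(2,1)], of q]
    by (simp add: q ac_simps)
  ultimately show ?thesis
    using assms by (simp add: ramanujan_poly_mult_prime_not_dvd dvd_diff)
qed

theorem theorem5:
  shows "(\<forall>n::nat. n \<ge> 1 \<longrightarrow>
           ramanujan_poly n =
             smult (of_nat n / of_nat (squarefree_kernel n))
               (pcompose (ramanujan_poly (squarefree_kernel n))
                  (monom 1 (n div squarefree_kernel n)))) \<and>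
         (\<forall>(n::nat) (p::nat). n \<ge> 1 \<longrightarrow> prime p \<longrightarrow>
           (p dvd n \<longrightarrow>
              ramanujan_poly (n * p) =
                smult (of_nat p) (pcompose (ramanujan_poly n) (monom 1 p))) \<and>
           (\<not> p dvd n \<longrightarrow>
              ramanujan_poly (n * p) =
                smult (of_nat p) (pcompose (ramanujan_poly n) (monom 1 p))
                - (\<Sum>j<p. monom 1 (j * n)) * ramanujan_poly n)) \<and>
         (\<forall>(n::nat) (p::nat). n > 1 \<longrightarrow> prime p \<longrightarrow> \<not> p dvd n \<longrightarrow>
           (1 - monom 1 p) dvd ramanujan_poly (n * p))"
proof (intro conjI allI impI)
qed (use ramanujan_poly_squarefree_kernel ramanujan_poly_mult_prime_dvd
       ramanujan_poly_mult_prime_not_dvd one_minus_monom_dvd_ramanujan_poly in \<open>simp_all add: Suc_le_eq\<close>)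

end
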